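(* Let $\{u_k\}_{k=1}^N$, $\{v_k\}_{k=1}^N$ be collections of nonnegative numbers such that $u_k+v_k>0$ for every $k\in\{1,\dots,N\}$, $\sum_{k=1}^Nv_k>0$, and $\sum_{k=1}^N(u_k+v_k)=1$. Let $\{l_k\}_{k=1}^N$ be a collection of positive numbers that is linearly independent over the field $\mathbb Q$. Let $X_1,X_2$ be continuous functions on $\mathbb R$ satisfying $X_j(t)=o(t^{-2})$ as $t\to\pm\infty$, $j=1,2$. Then there exists a unique pair of continuous functions $Z_1,Z_2$ on $\mathbb R$ satisfying, for $j=1,2$, $$Z_j(t)=X_j(t)+\sum_{k=1}^N\bigl(u_kZ_j(t-l_k)+v_kZ_{3-j}(t-l_k)\bigr)\ \text{ for all }t\in\mathbb R,\qquad\lim_{t\to-\infty}Z_j(t)=0.$$ Moreover, for $j=1,2$, $$\lim_{t\to+\infty}Z_j(t)=\frac1{2J}\int_{-\infty}^{+\infty}(X_1+X_2)\,d\mu,$$ where $\mu$ is Lebesgue measure on $\mathbb R$ and $J=\sum_{k=1}^N(u_k+v_k)\,l_k$.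
   Formalization: The limit at +∞ is asserted only for N ≥ 2, since it fails for N = 1 (with X_2 = 0 and X_1 a narrow bump, Z_1+Z_2 tends to a non-constant periodic function); existence and uniqueness are asserted for every N. *)

theory Defs
  imports "HOL-Analysis.Analysis" "HOL-Library.Landau_Symbols"
begin

definition renewal_solution ::
  "nat \<Rightarrow> (nat \<Rightarrow> real) \<Rightarrow> (nat \<Rightarrow> real) \<Rightarrow> (nat \<Rightarrow> real) \<Rightarrow> (real \<Rightarrow> real) \<Rightarrow> (real \<Rightarrow> real) \<Rightarrow>
    (real \<Rightarrow> real) \<times> (real \<Rightarrow> real) \<Rightarrow> bool" where
  "renewal_solution N u v l X1 X2 = (\<lambda>(Z1, Z2).
     continuous_on UNIV Z1 \<and> continuous_on UNIV Z2 \<and>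
     (\<forall>t. Z1 t = X1 t + (\<Sum>k=1..N. u k * Z1 (t - l k) + v k * Z2 (t - l k))) \<and>
     (\<forall>t. Z2 t = X2 t + (\<Sum>k=1..N. u k * Z2 (t - l k) + v k * Z1 (t - l k))) \<and>
     (Z1 \<longlongrightarrow> 0) at_bot \<and> (Z2 \<longlongrightarrow> 0) at_bot)"

text \<open>\<open>module.independent\<close> speaks about sets; a family \<open>l\<close> is linearly independent iff it is
  injective and its range is independent.\<close>

definition rat_independent_family :: "nat set \<Rightarrow> (nat \<Rightarrow> real) \<Rightarrow> bool" where
  "rat_independent_family I l \<longleftrightarrow>
     inj_on l I \<and> module.independent (\<lambda>q. (*) (real_of_rat q)) (l ` I)"

lemma vector_space_real_over_rat: "vector_space (\<lambda>q. (*) (real_of_rat q))"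
  by standard (simp_all add: algebra_simps of_rat_add of_rat_mult)

end

theory Submission
  imports Defs "HOL-Probability.Sinc_Integral" "HOL-Real_Asymp.Real_Asymp"
begin

text \<open>
  The functions \<open>Z1 + Z2\<close> and \<open>Z1 - Z2\<close> solve scalar equations
  \<open>W t = X t + (\<Sum>k. q k * W (t - l k))\<close> with weights \<open>q = u + v\<close> and \<open>q = u - v\<close>.
  Comparing with the superharmonic function \<open>arctan t + pi / 2\<close> gives uniqueness, convergence of
  the Neumann series, boundedness, and (applied to \<open>W (t + h) - W t\<close>) uniform continuity.

  The derivative of the energy \<open>\<Sum>k. (u k + v k) * \<integral>(t - l k)..t. W\<^sup>2\<close> is \<open>2 W X\<close> minus the
  nonnegative quantity
  \<open>\<Sum>k. u k * (W (t - l k) - W t)\<^sup>2 + v k * (W (t - l k) + W t)\<^sup>2\<close>, which therefore tends to 0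
  along \<open>t \<rightarrow> \<infinity>\<close> since the energy is bounded and \<open>W\<close> is uniformly continuous. So
  \<open>W (t - 2 * l k) - W t \<rightarrow> 0\<close> for all \<open>k\<close>, and since two of the \<open>l k\<close> have irrational ratio,
  \<open>W (t - s) - W t \<rightarrow> 0\<close> for all \<open>s\<close>. If some \<open>v k > 0\<close>, then also \<open>W (t - l k) + W t \<rightarrow> 0\<close>,
  hence \<open>W \<rightarrow> 0\<close>. If \<open>v = 0\<close>, then \<open>\<Sum>k. u k * \<integral>(t - l k)..t. W\<close> has derivative \<open>X\<close>, and
  slow variation of \<open>W\<close> identifies its limit \<open>\<integral> X\<close> with \<open>J\<close> times that of \<open>W\<close>.
\<close>

subsection \<open>Forcing terms of quadratic decay\<close>

text \<open>The second clause is continuity of translation in the sup norm weighted by 1 + t^2. It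
  makes \<open>X (t + h) - X t\<close> a small forcing term of the same type as \<open>X\<close>,
  which later yields uniform continuity of solutions.\<close>

definition quadratically_tame :: "(real \<Rightarrow> real) \<Rightarrow> bool" where
  "quadratically_tame X \<longleftrightarrow>
     (\<exists>C. \<forall>t. \<bar>X t\<bar> \<le> C / (1 + t\<^sup>2)) \<and>
     (\<forall>e>0. \<exists>d>0. \<forall>h t. \<bar>h\<bar> < d \<longrightarrow> \<bar>X (t + h) - X t\<bar> \<le> e / (1 + t\<^sup>2))"

lemma one_plus_square_pos: "0 < 1 + (t::real)\<^sup>2"
  by (simp add: add_pos_nonneg)

lemma uniformly_continuous_vanishing_at_infinity:
  fixes Y :: "real \<Rightarrow> real"
  assumes cont: "continuous_on UNIV Y" and "(Y \<longlongrightarrow> 0) at_top" "(Y \<longlongrightarrow> 0) at_bot"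
  shows "uniformly_continuous_on UNIV Y" "\<exists>C. \<forall>t. \<bar>Y t\<bar> \<le> C"
proof -
  have small: "\<exists>R. \<forall>t. \<bar>t\<bar> \<ge> R \<longrightarrow> \<bar>Y t\<bar> < e" if "e > 0" for e
  proof -
    have "\<forall>\<^sub>F t in at_top. \<bar>Y t\<bar> < e" "\<forall>\<^sub>F t in at_bot. \<bar>Y t\<bar> < e"
      using assms(2,3) that by (auto simp: tendsto_iff)
    then obtain a b where "\<forall>t\<ge>a. \<bar>Y t\<bar> < e" "\<forall>t\<le>b. \<bar>Y t\<bar> < e"
      by (auto simp: eventually_at_top_linorder eventually_at_bot_linorder)
    then have "\<forall>t. \<bar>t\<bar> \<ge> max a (-b) \<longrightarrow> \<bar>Y t\<bar> < e"
      by (auto simp: abs_if)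
    then show ?thesis by blast
  qed
  show "uniformly_continuous_on UNIV Y"
    unfolding uniformly_continuous_on_def
  proof (intro allI impI)
    fix e :: real assume "e > 0"
    then obtain R where R: "\<And>t. \<bar>t\<bar> \<ge> R \<Longrightarrow> \<bar>Y t\<bar> < e/2"
      using small[of "e/2"] by auto
    have "uniformly_continuous_on {-R-1..R+1} Y"
      by (rule compact_uniformly_continuous) (auto intro: continuous_on_subset[OF cont])
    then obtain d where d: "d > 0"
      "\<And>s t. s \<in> {-R-1..R+1} \<Longrightarrow> t \<in> {-R-1..R+1} \<Longrightarrow> dist s t < d \<Longrightarrow> dist (Y s) (Y t) < e"
      unfolding uniformly_continuous_on_def using \<open>e > 0\<close> by metis
    \<comment> \<open>The margin 1 around {-R..R} together with the bound 1 on the distance ensures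
      that if one point leaves the compact interval, both points lie where \<open>Y\<close> is below
      e/2.\<close>
    have "dist (Y s) (Y t) < e" if "dist s t < min d 1" for s t
    proof (cases "s \<in> {-R-1..R+1} \<and> t \<in> {-R-1..R+1}")
      case True
      then show ?thesis using d that by auto
    next
      case False
      then have "\<bar>s\<bar> \<ge> R" "\<bar>t\<bar> \<ge> R"
        using that by (auto simp: dist_real_def)
      then show ?thesis using R[of s] R[of t] by (auto simp: dist_real_def)
    qed
    then show "\<exists>d>0. \<forall>t\<in>UNIV. \<forall>s\<in>UNIV. dist s t < d \<longrightarrow> dist (Y s) (Y t) < e"
      using d(1) by (intro exI[of _ "min d 1"]) auto
  qed
  obtain R where R: "\<And>t. \<bar>t\<bar> \<ge> R \<Longrightarrow> \<bar>Y t\<bar> < 1"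
    using small[of 1] by auto
  have "bounded (Y ` {-R..R})"
    by (intro compact_imp_bounded compact_continuous_image continuous_on_subset[OF cont]) auto
  then obtain B where B: "\<And>t. t \<in> {-R..R} \<Longrightarrow> \<bar>Y t\<bar> \<le> B"
    unfolding bounded_iff by (metis imageI real_norm_def)
  have "\<bar>Y t\<bar> \<le> max B 1" for t
    using R[of t] B[of t] by (smt (verit) atLeastAtMost_iff)
  then show "\<exists>C. \<forall>t. \<bar>Y t\<bar> \<le> C" by blast
qed

text \<open>The weighted function (1 + t^2) X(t) is continuous and vanishes at both infinities, so
  it is bounded and uniformly continuous. Both properties survive division by the weight because the
  weight changes by a factor near 1 under small shifts.\<close>

lemma quadratically_tame_smallo:
  assumes cont: "continuous_on UNIV X"
    and top: "X \<in> o[at_top](\<lambda>t. 1 / t\<^sup>2)" and bot: "X \<in> o[at_bot](\<lambda>t. 1 / t\<^sup>2)"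
  shows "quadratically_tame X"
proof -
  define Y where "Y t = (1 + t\<^sup>2) * X t" for t
  have contY: "continuous_on UNIV Y"
    unfolding Y_def by (intro continuous_intros cont)
  have "(\<lambda>t::real. 1 / t\<^sup>2) \<in> O[at_top](\<lambda>t. 1 / (1 + t\<^sup>2))" by real_asymp
  from landau_o.small_big_trans[OF top this] have "(Y \<longlongrightarrow> 0) at_top"
    by (drule_tac smalloD_tendsto) (simp add: Y_def [abs_def] mult.commute)
  moreover have "(\<lambda>t::real. 1 / t\<^sup>2) \<in> O[at_bot](\<lambda>t. 1 / (1 + t\<^sup>2))" by real_asymp
  from landau_o.small_big_trans[OF bot this] have "(Y \<longlongrightarrow> 0) at_bot"
    by (drule_tac smalloD_tendsto) (simp add: Y_def [abs_def] mult.commute)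
  ultimately have uc: "uniformly_continuous_on UNIV Y" and "\<exists>C. \<forall>t. \<bar>Y t\<bar> \<le> C"
    using uniformly_continuous_vanishing_at_infinity[OF contY] by auto
  then obtain C where C: "\<And>t. \<bar>Y t\<bar> \<le> C" by auto
  have C0: "C \<ge> 0" using C[of 0] by linarith
  have "\<bar>X t\<bar> \<le> C / (1 + t\<^sup>2)" for t
    using C[of t] one_plus_square_pos[of t] by (simp add: Y_def field_simps abs_mult)
  moreover have "\<exists>d>0. \<forall>h t. \<bar>h\<bar> < d \<longrightarrow> \<bar>X (t + h) - X t\<bar> \<le> e / (1 + t\<^sup>2)" if e: "e > 0" for e
  proof -
    obtain d where d: "d > 0" "\<And>s t. dist s t < d \<Longrightarrow> dist (Y s) (Y t) < e / 6"
      using uc e unfolding uniformly_continuous_on_def by (metis UNIV_I divide_pos_pos zero_less_numeral)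
    \<comment> \<open>The bound 1 keeps the weight ratio \<open>r\<close> at most 3, so the modulus
      for e/6 contributes at most e/2; the last bound makes 2 |h| C at most e/2. Using C + 1 avoids
      division by zero.\<close>
    define d' where "d' = min d (min 1 (e / (4 * (C + 1))))"
    have "d' > 0" using d e C0 by (simp add: d'_def)
    moreover have "\<bar>X (t + h) - X t\<bar> \<le> e / (1 + t\<^sup>2)" if h: "\<bar>h\<bar> < d'" for h t
    proof -
      define s where "s = t + h"
      \<comment> \<open>The ratio of weights satisfies |r - 1| \<le> 2 |h|, because t^2 - s^2 = h^2
        - 2 h s and 2 |s| \<le> 1 + s^2.\<close>
      define r where "r = (1 + t\<^sup>2) / (1 + s\<^sup>2)"
      have h1: "\<bar>h\<bar> < d" "\<bar>h\<bar> < 1" "\<bar>h\<bar> < e / (4 * (C + 1))" using h by (auto simp: d'_def)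
      have "2 * \<bar>s\<bar> \<le> 1 + s\<^sup>2"
        using zero_le_power2[of "\<bar>s\<bar> - 1"] by (simp add: power2_eq_square algebra_simps)
      then have "\<bar>h\<bar> * (2 * \<bar>s\<bar>) \<le> \<bar>h\<bar> * (1 + s\<^sup>2)" by (intro mult_left_mono) auto
      moreover have "h\<^sup>2 \<le> \<bar>h\<bar>"
        using h1(2) mult_left_le[of "\<bar>h\<bar>" "\<bar>h\<bar>"] by (simp add: power2_eq_square)
      moreover have "0 \<le> \<bar>h\<bar> * s\<^sup>2" by simp
      moreover have "\<bar>t\<^sup>2 - s\<^sup>2\<bar> \<le> \<bar>h\<bar> * (2 * \<bar>s\<bar>) + h\<^sup>2"
      proof -
        have "t\<^sup>2 - s\<^sup>2 = h\<^sup>2 - h * (2 * s)"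
          by (simp add: s_def power2_eq_square algebra_simps)
        then show ?thesis by (metis abs_triangle_ineq4 abs_mult abs_numeral abs_power2 add.commute)
      qed
      ultimately have "\<bar>t\<^sup>2 - s\<^sup>2\<bar> \<le> 2 * \<bar>h\<bar> * (1 + s\<^sup>2)"
        unfolding distrib_left mult_1_right by linarith
      moreover have "r - 1 = (t\<^sup>2 - s\<^sup>2) / (1 + s\<^sup>2)"
        using one_plus_square_pos[of s] by (simp add: r_def field_simps)
      ultimately have r1: "\<bar>r - 1\<bar> \<le> 2 * \<bar>h\<bar>"
        using one_plus_square_pos[of s] by (simp add: divide_le_eq)
      then have r: "0 \<le> r" "r \<le> 3"
        using h1 by (simp_all add: r_def)
      have "r * Y s = (1 + t\<^sup>2) * X s"
        using one_plus_square_pos[of s] by (simp add: r_def Y_def)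
      then have "(1 + t\<^sup>2) * (X s - X t) = r * (Y s - Y t) + (r - 1) * Y t"
        by (simp add: right_diff_distrib left_diff_distrib Y_def[of t])
      also have "\<bar>\<dots>\<bar> \<le> \<bar>r\<bar> * \<bar>Y s - Y t\<bar> + \<bar>r - 1\<bar> * \<bar>Y t\<bar>"
        by (metis abs_mult abs_triangle_ineq)
      also have "\<dots> \<le> 3 * (e / 6) + 2 * \<bar>h\<bar> * C"
        using r r1 C[of t] d(2)[of s t] h1 C0
        by (intro add_mono mult_mono) (auto simp: s_def dist_real_def)
      also have "\<dots> \<le> e"
      proof -
        have "\<bar>h\<bar> * (C + 1) \<le> e / 4" using h1(3) C0 by (simp add: field_simps)
        then have "\<bar>h\<bar> * C \<le> e / 4" unfolding distrib_left by linarith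
        then show ?thesis by linarith
      qed
      finally have "(1 + t\<^sup>2) * \<bar>X s - X t\<bar> \<le> e"
        using one_plus_square_pos[of t] by (simp add: abs_mult)
      then show ?thesis
        using one_plus_square_pos[of t] by (simp add: s_def field_simps)
    qed
    ultimately show ?thesis by blast
  qed
  ultimately show ?thesis unfolding quadratically_tame_def by blast
qed

lemma quadratically_tame_add:
  assumes "quadratically_tame X" "quadratically_tame Y"
  shows "quadratically_tame (\<lambda>t. X t + Y t)"
  unfolding quadratically_tame_def
proof (intro conjI allI impI)
  obtain C D where "\<And>t. \<bar>X t\<bar> \<le> C / (1 + t\<^sup>2)" "\<And>t. \<bar>Y t\<bar> \<le> D / (1 + t\<^sup>2)"
    using assms unfolding quadratically_tame_def by blast
  then have "\<bar>X t + Y t\<bar> \<le> (C + D) / (1 + t\<^sup>2)" for t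
    unfolding add_divide_distrib by (meson abs_triangle_ineq add_mono order_trans)
  then show "\<exists>C. \<forall>t. \<bar>X t + Y t\<bar> \<le> C / (1 + t\<^sup>2)" by blast
next
  fix e :: real assume "0 < e"
  then have "0 < e / 2" by simp
  then obtain c d where cd: "0 < c" "0 < d"
    "\<And>h t. \<bar>h\<bar> < c \<Longrightarrow> \<bar>X (t + h) - X t\<bar> \<le> e / 2 / (1 + t\<^sup>2)"
    "\<And>h t. \<bar>h\<bar> < d \<Longrightarrow> \<bar>Y (t + h) - Y t\<bar> \<le> e / 2 / (1 + t\<^sup>2)"
    using assms unfolding quadratically_tame_def by metis
  have "\<bar>X (t + h) + Y (t + h) - (X t + Y t)\<bar> \<le> e / (1 + t\<^sup>2)" if "\<bar>h\<bar> < min c d" for h t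
  proof -
    have "e / 2 / (1 + t\<^sup>2) = e / (1 + t\<^sup>2) / 2" by (simp add: mult.commute)
    then show ?thesis using cd(3)[of h t] cd(4)[of h t] that by linarith
  qed
  then show "\<exists>d>0. \<forall>h t. \<bar>h\<bar> < d \<longrightarrow> \<bar>X (t + h) + Y (t + h) - (X t + Y t)\<bar> \<le> e / (1 + t\<^sup>2)"
    using cd(1,2) by (intro exI[of _ "min c d"]) auto
qed

lemma quadratically_tame_minus:
  assumes "quadratically_tame X"
  shows "quadratically_tame (\<lambda>t. - X t)"
proof -
  have eq: "\<bar>- X s - - X t\<bar> = \<bar>X s - X t\<bar>" for s t by linarith
  show ?thesis
    using assms unfolding quadratically_tame_def eq abs_minus_cancel .
qed

section \<open>Integrals over the line and antiderivatives\<close>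

lemma integrable_quadratic_decay:
  fixes X :: "real \<Rightarrow> real"
  assumes "continuous_on UNIV X" "\<And>t. \<bar>X t\<bar> \<le> C / (1 + t\<^sup>2)"
  shows "integrable lborel X"
proof (rule Bochner_Integration.integrable_bound)
  have "integrable lborel (\<lambda>t::real. inverse (1 + t\<^sup>2))"
    using integrable_inverse_1_plus_square by (simp add: set_integrable_def)
  then show "integrable lborel (\<lambda>t::real. C * inverse (1 + t\<^sup>2))" by simp
  show "X \<in> borel_measurable lborel"
    using borel_measurable_continuous_onI[OF assms(1)] by simp
  show "AE t in lborel. norm (X t) \<le> norm (C * inverse (1 + t\<^sup>2))"
  proof (intro AE_I2)
    fix t :: real
    have "\<bar>X t\<bar> \<le> C * inverse (1 + t\<^sup>2)" using assms(2)[of t] by (simp add: divide_inverse)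
    then show "norm (X t) \<le> norm (C * inverse (1 + t\<^sup>2))" by (simp del: abs_mult)
  qed
qed

text \<open>Dominated convergence over the intervals {-T..T}, with the fundamental theorem of
  calculus on each of them.\<close>

lemma tendsto_symmetric_integral:
  fixes X :: "real \<Rightarrow> real"
  assumes cont: "continuous_on UNIV X" and int: "integrable lborel X"
    and F: "\<And>t. (F has_real_derivative X t) (at t)"
  shows "((\<lambda>t. F t - F (-t)) \<longlongrightarrow> (LINT t|lebesgue. X t)) at_top"
proof -
  have meas [measurable]: "X \<in> borel_measurable lborel"
    using borel_measurable_continuous_onI[OF cont] by simp
  have "((\<lambda>T. LINT t|lborel. indicator {-T..T} t *\<^sub>R X t) \<longlongrightarrow> (LINT t|lborel. X t)) at_top"
  proof (rule integral_dominated_convergence_at_top[where w = "\<lambda>t. \<bar>X t\<bar>"])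
    show "AE t in lborel. ((\<lambda>T. indicat_real {-T..T} t *\<^sub>R X t) \<longlongrightarrow> X t) at_top"
    proof (intro AE_I2 tendsto_eventually)
      fix t
      show "\<forall>\<^sub>F T in at_top. indicat_real {-T..T} t *\<^sub>R X t = X t"
        using eventually_ge_at_top[of "\<bar>t\<bar>"] by eventually_elim (auto simp: indicator_def)
    qed
  qed (use int in \<open>auto simp: indicator_def\<close>)
  then have lim: "((\<lambda>T. LINT t|lborel. indicator {-T..T} t *\<^sub>R X t) \<longlongrightarrow> (LINT t|lebesgue. X t)) at_top"
    by (simp add: integral_completion)
  have "\<forall>\<^sub>F T in at_top. (LINT t|lborel. indicator {-T..T} t *\<^sub>R X t) = F T - F (-T)"
    using eventually_ge_at_top[of 0]
  proof eventually_elim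
    case (elim T)
    show ?case
      by (rule integral_FTC_Icc)
        (use elim F continuous_on_subset[OF cont] in
          \<open>auto simp flip: has_real_derivative_iff_has_vector_derivative
            intro: has_field_derivative_at_within\<close>)
  qed
  with lim show ?thesis by (rule Lim_transform_eventually)
qed

text \<open>With a global antiderivative, every moving-window integral below becomes a difference
  \<open>F t - F (t - s)\<close>, which can be differentiated directly.\<close>

lemma continuous_antiderivative:
  fixes f :: "real \<Rightarrow> real"
  assumes "continuous_on UNIV f"
  obtains F where "\<And>t. (F has_real_derivative f t) (at t)"
proof -
  have "\<exists>F. \<forall>x::real. -\<infinity> < ereal x \<longrightarrow> ereal x < \<infinity> \<longrightarrow> (F has_vector_derivative f x) (at x)"
    by (rule einterval_antiderivative) (use assms in \<open>auto simp: continuous_on_eq_continuous_at\<close>)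
  then show ?thesis
    using that by (auto simp: has_real_derivative_iff_has_vector_derivative)
qed

subsection \<open>Asymptotic periods and slow variation\<close>

lemma uniformly_continuous_realE:
  fixes W :: "real \<Rightarrow> real"
  assumes "uniformly_continuous_on UNIV W" "0 < e"
  obtains d where "0 < d" "\<And>s t. \<bar>s - t\<bar> < d \<Longrightarrow> \<bar>W s - W t\<bar> < e"
proof -
  obtain d where "0 < d" "\<forall>t\<in>UNIV. \<forall>s\<in>UNIV. dist s t < d \<longrightarrow> dist (W s) (W t) < e"
    using assms unfolding uniformly_continuous_on_def by blast
  then show ?thesis using that by (auto simp: dist_real_def)
qed

lemma uniformly_continuous_shift:
  fixes W :: "real \<Rightarrow> real"
  assumes "uniformly_continuous_on UNIV W"
  shows "uniformly_continuous_on UNIV (\<lambda>t. W (t - s))"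
  unfolding uniformly_continuous_on_def
proof (intro allI impI)
  fix e :: real assume "0 < e"
  then obtain d where "0 < d" and d: "\<And>s t. \<bar>s - t\<bar> < d \<Longrightarrow> \<bar>W s - W t\<bar> < e"
    using uniformly_continuous_realE[OF assms] by blast
  then show "\<exists>d>0. \<forall>t\<in>UNIV. \<forall>t'\<in>UNIV. dist t' t < d \<longrightarrow> dist (W (t' - s)) (W (t - s)) < e"
    by (intro exI[of _ d]) (auto simp: dist_real_def)
qed

text \<open>The point of the notion is that these \<open>s\<close>, of either sign, form an additive
  subgroup of the reals, as the next lemmas show.\<close>

definition asymptotic_period :: "(real \<Rightarrow> real) \<Rightarrow> real \<Rightarrow> bool" where
  "asymptotic_period W s \<longleftrightarrow> ((\<lambda>t. W (t - s) - W t) \<longlongrightarrow> 0) at_top"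

lemma filterlim_minus_const_at_top: "filterlim (\<lambda>t::real. t - r) at_top at_top"
  by real_asymp

lemma asymptotic_period_add:
  assumes "asymptotic_period W s" "asymptotic_period W r"
  shows "asymptotic_period W (s + r)"
proof -
  have "((\<lambda>t. W (t - r - s) - W (t - r)) \<longlongrightarrow> 0) at_top"
    using assms(1) unfolding asymptotic_period_def
    by (rule filterlim_compose[OF _ filterlim_minus_const_at_top])
  from tendsto_add[OF this assms(2)[unfolded asymptotic_period_def]]
  show ?thesis by (simp add: asymptotic_period_def algebra_simps)
qed

lemma asymptotic_period_minus:
  assumes "asymptotic_period W s"
  shows "asymptotic_period W (- s)"
proof -
  have "((\<lambda>t. W (t - (- s) - s) - W (t - (- s))) \<longlongrightarrow> 0) at_top"
    using assms unfolding asymptotic_period_def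
    by (rule filterlim_compose[OF _ filterlim_minus_const_at_top])
  from tendsto_minus[OF this] show ?thesis by (simp add: asymptotic_period_def)
qed

lemma asymptotic_period_int_mult:
  assumes "asymptotic_period W s"
  shows "asymptotic_period W (of_int n * s)"
proof -
  have nat: "asymptotic_period W (real m * s)" for m
  proof (induction m)
    case 0
    then show ?case by (simp add: asymptotic_period_def)
  next
    case (Suc m)
    then show ?case using asymptotic_period_add[OF assms Suc.IH] by (simp add: distrib_right)
  qed
  show ?thesis
    using nat asymptotic_period_minus[OF nat] by (cases n rule: int_cases2) auto
qed

text \<open>The group generated by two numbers of irrational ratio contains arbitrarily small
  nonzero elements. Some multiple of such an element lies close to \<open>s\<close>, and uniform
  continuity bridges the remaining gap.\<close>

lemma asymptotic_period_dense:
  assumes uc: "uniformly_continuous_on UNIV W"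
    and a: "asymptotic_period W a" and b: "asymptotic_period W b"
    and irrational: "a / b \<notin> \<rat>"
  shows "asymptotic_period W s"
  unfolding asymptotic_period_def tendsto_iff
proof (intro allI impI)
  fix e :: real assume "0 < e"
  then obtain d where "0 < d" and d: "\<And>s t. \<bar>s - t\<bar> < d \<Longrightarrow> \<bar>W s - W t\<bar> < e / 2"
    using uniformly_continuous_realE[OF uc, of "e / 2"] by auto
  have "b \<noteq> 0" using irrational by auto
  \<comment> \<open>Dirichlet approximation has error below 1/N; multiplied by |b| this must fall
    below the modulus \<open>d\<close>.\<close>
  obtain N :: nat where N: "\<bar>b\<bar> / d < real N" using reals_Archimedean2 by blast
  then have "0 < real N" using \<open>0 < d\<close> by (smt (verit) divide_nonneg_pos)
  then have "0 < N" by simp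
  then obtain h k where k: "0 < k" "\<bar>of_int k * (a / b) - of_int h\<bar> < 1 / real N"
    using Dirichlet_approx[of N "a / b"] by metis
  define g where "g = of_int k * a + of_int (- h) * b"
  have g_eq: "g = (of_int k * (a / b) - of_int h) * b"
    using \<open>b \<noteq> 0\<close> by (simp add: g_def algebra_simps)
  have "\<bar>g\<bar> < 1 / real N * \<bar>b\<bar>"
    unfolding g_eq abs_mult using k(2) \<open>b \<noteq> 0\<close> by (intro mult_strict_right_mono) auto
  also have "\<dots> < d" using N \<open>0 < d\<close> \<open>0 < real N\<close> by (simp add: field_simps)
  finally have "\<bar>g\<bar> < d" .
  have "g \<noteq> 0"
  proof
    assume "g = 0"
    then have "a / b = of_int h / of_int k"
      using \<open>b \<noteq> 0\<close> k(1) by (simp add: g_def field_simps)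
    then show False using irrational by simp
  qed
  have "asymptotic_period W g"
    unfolding g_def by (intro asymptotic_period_add asymptotic_period_int_mult a b)
  \<comment> \<open>Rounding s/g down leaves n g within |g| < d of \<open>s\<close>, whatever the
    sign of \<open>g\<close>.\<close>
  define n where "n = \<lfloor>s / g\<rfloor>"
  have "s - of_int n * g = frac (s / g) * g"
    using \<open>g \<noteq> 0\<close> by (simp add: n_def frac_def algebra_simps)
  then have "\<bar>s - of_int n * g\<bar> \<le> \<bar>g\<bar>"
    using frac_lt_1[of "s / g"] by (simp add: abs_mult mult_left_le_one_le)
  then have close: "\<bar>(t - s) - (t - of_int n * g)\<bar> < d" for t
    using \<open>\<bar>g\<bar> < d\<close> by simp
  have "asymptotic_period W (of_int n * g)"
    by (rule asymptotic_period_int_mult) fact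
  then have "\<forall>\<^sub>F t in at_top. dist (W (t - of_int n * g) - W t) 0 < e / 2"
    using \<open>0 < e\<close> unfolding asymptotic_period_def by (intro tendstoD) auto
  then show "\<forall>\<^sub>F t in at_top. dist (W (t - s) - W t) 0 < e"
  proof eventually_elim
    case (elim t)
    then show ?case
      using d[OF close[of t]] dist_triangle[of "W (t - s)" "W t" "W (t - of_int n * g)"]
      unfolding dist_real_def diff_0_right by linarith
  qed
qed

section \<open>Moving-window means and energy decay\<close>

lemma antiderivative_increment:
  fixes H W :: "real \<Rightarrow> real"
  assumes "\<And>t. (H has_real_derivative W t) (at t)" "0 < s"
  obtains z where "t - s < z" "z < t" "H t - H (t - s) = s * W z"
  using MVT2[of "t - s" t H W] assms by auto

lemma increment_has_derivative:
  fixes H W :: "real \<Rightarrow> real"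
  assumes "\<And>t. (H has_real_derivative W t) (at t)"
  shows "((\<lambda>t. H t - H (t - s)) has_real_derivative W t - W (t - s)) (at t)"
  using assms[of "t + (- s)"] DERIV_shift[of H "W (t + (- s))" t "- s"]
  by (intro DERIV_diff assms) simp

text \<open>The window of length \<open>s\<close> is cut into pieces shorter than a modulus of
  uniform continuity. Pointwise slow variation then has to be used at finitely many shifts
  only.\<close>

lemma slowly_varying_mean:
  assumes uc: "uniformly_continuous_on UNIV W"
    and slow: "\<And>s. asymptotic_period W s"
    and H: "\<And>t. (H has_real_derivative W t) (at t)" and "0 < s"
  shows "((\<lambda>t. H t - H (t - s) - s * W t) \<longlongrightarrow> 0) at_top"
  unfolding tendsto_iff
proof (intro allI impI)
  fix e :: real assume "0 < e"
  \<comment> \<open>The accumulated error will be 2 s e' = 2 e / 3, strictly below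
    \<open>e\<close>.\<close>
  define e' where "e' = e / (3 * s)"
  have "0 < e'" using \<open>0 < e\<close> \<open>0 < s\<close> by (simp add: e'_def)
  then obtain d where "0 < d" and d: "\<And>s t. \<bar>s - t\<bar> < d \<Longrightarrow> \<bar>W s - W t\<bar> < e'"
    using uniformly_continuous_realE[OF uc] by blast
  obtain n :: nat where n: "s / d < real n" using reals_Archimedean2 by blast
  then have "0 < real n" using \<open>0 < d\<close> \<open>0 < s\<close> by (smt (verit) divide_nonneg_pos)
  define r where "r = s / real n"
  have r: "0 < r" "r < d" "s = real n * r"
    using n \<open>0 < real n\<close> \<open>0 < s\<close> \<open>0 < d\<close> by (auto simp: r_def field_simps)
  have base: "\<bar>H t - H (t - r) - r * W t\<bar> \<le> r * e'" for t
  proof -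
    obtain z where z: "t - r < z" "z < t" "H t - H (t - r) = r * W z"
      using antiderivative_increment[OF H r(1)] by blast
    have "\<bar>W z - W t\<bar> \<le> e'" using d[of z t] z r by simp
    then have "r * \<bar>W z - W t\<bar> \<le> r * e'" using r by simp
    then show ?thesis using z(3) r(1) by (simp add: abs_mult flip: right_diff_distrib)
  qed
  have "\<forall>\<^sub>F t in at_top. \<bar>H t - H (t - real m * r) - real m * r * W t\<bar> \<le> 2 * real m * r * e'" for m
  proof (induction m)
    case 0
    then show ?case by simp
  next
    case (Suc m)
    have "\<forall>\<^sub>F t in at_top. dist (W (t - real m * r) - W t) 0 < e'"
      using slow[of "real m * r"] \<open>0 < e'\<close> unfolding asymptotic_period_def by (rule tendstoD)
    with Suc.IH show ?case
    proof eventually_elim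
      case (elim t)
      define t' where "t' = t - real m * r"
      \<comment> \<open>Each further piece costs two errors of r e': one for replacing its mean by
        \<open>W t'\<close> (uniform continuity), one for replacing \<open>W t'\<close> by
        \<open>W t\<close> (slow variation).\<close>
      have "H t - H (t - real (Suc m) * r) - real (Suc m) * r * W t =
          (H t - H t' - real m * r * W t) + (H t' - H (t' - r) - r * W t') + r * (W t' - W t)"
        by (simp add: t'_def algebra_simps)
      moreover have "\<bar>r * (W t' - W t)\<bar> \<le> r * e'"
        using elim(2) r(1) by (simp add: t'_def abs_mult)
      moreover have "2 * real (Suc m) * r * e' = 2 * real m * r * e' + r * e' + r * e'"
        by (simp add: algebra_simps)
      ultimately show ?case using elim(1) base[of t'] unfolding t'_def by linarith
    qed
  qed
  from this[of n] show "\<forall>\<^sub>F t in at_top. dist (H t - H (t - s) - s * W t) 0 < e"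
  proof eventually_elim
    case (elim t)
    have "2 * real n * r * e' = 2 * (s * e')" by (simp add: r(3))
    moreover have "s * e' = e / 3" using \<open>0 < s\<close> by (simp add: e'_def)
    ultimately show ?case
      using elim \<open>0 < e\<close> unfolding dist_real_def diff_0_right r(3)[symmetric] by linarith
  qed
qed

text \<open>A form of Barbalat's lemma. \<open>F\<close> is nondecreasing and bounded, so its growth
  over windows of fixed length is eventually small. Some point of each window then has small
  \<open>g\<close>, and uniform continuity carries this to the whole window.\<close>

lemma bounded_monotone_square_derivative:
  fixes F F' g :: "real \<Rightarrow> real"
  assumes F: "\<And>t. (F has_real_derivative F' t) (at t)" and bound: "\<And>t. F t \<le> M"
    and "0 < w" and dom: "\<And>t. w * (g t)\<^sup>2 \<le> F' t" and uc: "uniformly_continuous_on UNIV g"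
  shows "(g \<longlongrightarrow> 0) at_top"
  unfolding tendsto_iff
proof (intro allI impI)
  fix e :: real assume "0 < e"
  then obtain d where "0 < d" and d: "\<And>s t. \<bar>s - t\<bar> < d \<Longrightarrow> \<bar>g s - g t\<bar> < e / 2"
    using uniformly_continuous_realE[OF uc, of "e / 2"] by auto
  have F'_nonneg: "0 \<le> F' t" for t
    using dom[of t] \<open>0 < w\<close> by (smt (verit) mult_nonneg_nonneg zero_le_power2)
  have mono: "F s \<le> F t" if "s \<le> t" for s t
    using that F F'_nonneg by (meson DERIV_nonneg_imp_nondecreasing)
  \<comment> \<open>The least growth of \<open>F\<close> over a window of length d/2 on which |g|
    stays at least e/2.\<close>
  define eps where "eps = d / 2 * (w * (e / 2)\<^sup>2)"
  have "0 < eps" using \<open>0 < d\<close> \<open>0 < w\<close> \<open>0 < e\<close> by (simp add: eps_def)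
  have bdd: "bdd_above (range F)" using bound by (intro bdd_aboveI2)
  then obtain t0 where t0: "Sup (range F) - eps < F t0"
    using less_cSup_iff[of "range F" "Sup (range F) - eps"] \<open>0 < eps\<close> by auto
  show "\<forall>\<^sub>F t in at_top. dist (g t) 0 < e"
    using eventually_ge_at_top[of t0]
  proof eventually_elim
    case (elim t)
    obtain z where z: "t + d / 2 - d / 2 < z" "z < t + d / 2"
      "F (t + d / 2) - F (t + d / 2 - d / 2) = d / 2 * F' z"
      using antiderivative_increment[where s = "d / 2" and t = "t + d / 2", OF F] \<open>0 < d\<close> by auto
    have "F (t + d / 2) \<le> Sup (range F)" using bdd by (intro cSup_upper) auto
    then have "d / 2 * F' z < eps" using z(3) t0 mono[OF elim] by simp
    then have "F' z < w * (e / 2)\<^sup>2" using \<open>0 < d\<close> by (simp add: eps_def)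
    then have "w * (g z)\<^sup>2 < w * (e / 2)\<^sup>2" using dom[of z] by linarith
    then have "(g z)\<^sup>2 < (e / 2)\<^sup>2" using \<open>0 < w\<close> by simp
    then have "\<bar>g z\<bar> < e / 2" using \<open>0 < e\<close> using power2_less_imp_less[of "\<bar>g z\<bar>" "e / 2"] by simp
    moreover have "\<bar>g t - g z\<bar> < e / 2" using d[of t z] z(1,2) \<open>0 < d\<close> by simp
    ultimately show ?case
      using dist_triangle[of "g t" 0 "g z"] unfolding dist_real_def diff_0_right by linarith
  qed
qed

subsection \<open>The scalar renewal equation with signed weights\<close>

lemma abs_sum_le:
  fixes f g :: "'a \<Rightarrow> real"
  assumes "\<And>k. k \<in> K \<Longrightarrow> \<bar>f k\<bar> \<le> g k"
  shows "\<bar>sum f K\<bar> \<le> sum g K"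
  using sum_abs sum_mono[of K, OF assms] by (rule order_trans)

text \<open>Only u - v enters the equation, but the pair is kept: u + v is the probability weight
  used for comparison, and the energy treats \<open>u\<close> and \<open>v\<close>
  differently.\<close>

locale signed_renewal =
  fixes I :: "'a set" and u v l :: "'a \<Rightarrow> real"
  assumes finite: "finite I"
    and u_nonneg: "\<And>k. k \<in> I \<Longrightarrow> 0 \<le> u k"
    and v_nonneg: "\<And>k. k \<in> I \<Longrightarrow> 0 \<le> v k"
    and total: "(\<Sum>k\<in>I. u k + v k) = 1"
    and l_pos: "\<And>k. k \<in> I \<Longrightarrow> 0 < l k"
begin

text \<open>Continuity is left out on purpose: comparison and uniqueness work for arbitrary
  functions, and tame forcing gives uniform continuity afterwards.\<close>

definition solves :: "(real \<Rightarrow> real) \<Rightarrow> (real \<Rightarrow> real) \<Rightarrow> bool" where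
  "solves X W \<longleftrightarrow>
     (\<forall>t. W t = X t + (\<Sum>k\<in>I. (u k - v k) * W (t - l k))) \<and> (W \<longlongrightarrow> 0) at_bot"

lemma solves_eq: "solves X W \<Longrightarrow> W t = X t + (\<Sum>k\<in>I. (u k - v k) * W (t - l k))"
  unfolding solves_def by blast

lemma solves_at_bot: "solves X W \<Longrightarrow> (W \<longlongrightarrow> 0) at_bot"
  unfolding solves_def by blast

lemma solvesI:
  assumes "\<And>t. W t = X t + (\<Sum>k\<in>I. (u k - v k) * W (t - l k))" "(W \<longlongrightarrow> 0) at_bot"
  shows "solves X W"
  unfolding solves_def using assms by blast

lemma p_nonneg: "k \<in> I \<Longrightarrow> 0 \<le> u k + v k"
  using u_nonneg v_nonneg by fastforce

lemma abs_q_le: "k \<in> I \<Longrightarrow> \<bar>u k - v k\<bar> \<le> u k + v k"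
  using u_nonneg[of k] v_nonneg[of k] by auto

section \<open>Maximum principle and barrier\<close>

lemma nonempty: "I \<noteq> {}"
  using total by auto

lemma exists_weight_pos: "\<exists>k\<in>I. 0 < u k + v k"
proof (rule ccontr)
  assume "\<not> (\<exists>k\<in>I. 0 < u k + v k)"
  then have "(\<Sum>k\<in>I. u k + v k) \<le> 0"
    by (intro sum_nonpos) (auto simp: not_less)
  then show False using total by simp
qed

text \<open>\<open>D t\<close> is at most an average of values at least \<open>m\<close> earlier,
  where \<open>m\<close> is the smallest delay. A bound \<open>e\<close> valid to the left of
  \<open>T\<close> therefore spreads to the right in steps of \<open>m\<close>.\<close>

lemma subharmonic_nonpos:
  assumes sub: "\<And>t. D t \<le> (\<Sum>k\<in>I. (u k + v k) * D (t - l k))"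
    and lim: "(D \<longlongrightarrow> 0) at_bot"
  shows "D t \<le> 0"
proof (rule field_le_epsilon)
  fix e :: real assume e: "0 < e"
  define m where "m = Min (l ` I)"
  have m: "0 < m" "\<And>k. k \<in> I \<Longrightarrow> m \<le> l k"
    using finite nonempty l_pos by (auto simp: m_def)
  have "\<forall>\<^sub>F s in at_bot. D s \<le> e"
    using order_tendstoD(2)[OF lim e] by (auto elim: eventually_mono)
  then obtain T where T: "\<And>s. s \<le> T \<Longrightarrow> D s \<le> e"
    by (auto simp: eventually_at_bot_linorder)
  have step: "D s \<le> e" if "s \<le> T + real n * m" for n s
    using that
  proof (induction n arbitrary: s)
    case 0
    then show ?case using T by auto
  next
    case (Suc n)
    have "D s \<le> (\<Sum>k\<in>I. (u k + v k) * D (s - l k))" by (rule sub)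
    also have "\<dots> \<le> (\<Sum>k\<in>I. (u k + v k) * e)"
    proof (intro sum_mono mult_left_mono p_nonneg Suc.IH)
      fix k assume "k \<in> I"
      then show "s - l k \<le> T + real n * m"
        using m(2)[of k] Suc.prems by (simp add: algebra_simps)
    qed auto
    also have "\<dots> = e" using total by (simp flip: sum_distrib_right)
    finally show ?case .
  qed
  obtain n :: nat where "t - T < real n * m"
    using reals_Archimedean3[OF m(1)] by auto
  then show "D t \<le> 0 + e" using step[of t n] by simp
qed

text \<open>The barrier is an explicit bounded strictly superharmonic function: its defect
  \<open>barrier t - (\<Sum>k\<in>I. (u k + v k) * barrier (t - l k))\<close> dominates a multiple of
  \<open>1 / (1 + t\<^sup>2)\<close>, so it controls every solution with forcing of that size.\<close>

definition barrier :: "real \<Rightarrow> real" where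
  "barrier t = arctan t + pi / 2"

lemma barrier_nonneg: "0 \<le> barrier t"
  using arctan_lbound[of t] by (simp add: barrier_def)

lemma barrier_le_pi: "barrier t \<le> pi"
  using arctan_ubound[of t] by (simp add: barrier_def)

lemma tendsto_barrier: "(barrier \<longlongrightarrow> 0) at_bot"
proof -
  have "((\<lambda>t. arctan t + pi / 2) \<longlongrightarrow> - (pi / 2) + pi / 2) at_bot"
    by (intro tendsto_intros tendsto_arctan_at_bot)
  then show ?thesis by (simp add: barrier_def [abs_def])
qed

text \<open>By the mean value theorem the increment is s / (1 + z^2) with |z| \<le> |t| + s, and 1 +
  z^2 \<le> (2 + 2 s^2)(1 + t^2) separates the dependence on \<open>s\<close> from that on
  \<open>t\<close>.\<close>

lemma arctan_increment_ge:
  assumes "0 < s"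
  shows "s / (2 + 2 * s\<^sup>2) / (1 + t\<^sup>2) \<le> arctan t - arctan (t - s)"
proof -
  obtain z where z: "t - s < z" "z < t" and eq: "arctan t - arctan (t - s) = (t - (t - s)) * inverse (1 + z\<^sup>2)"
    using MVT2[of "t - s" t arctan "\<lambda>x. inverse (1 + x\<^sup>2)"] assms DERIV_arctan by auto
  have "\<bar>z\<bar> \<le> \<bar>t\<bar> + s" using z by auto
  then have "z\<^sup>2 \<le> (\<bar>t\<bar> + s)\<^sup>2" using assms by (metis abs_ge_zero abs_le_square_iff abs_of_nonneg add_nonneg_nonneg less_imp_le)
  also have "\<dots> \<le> 2 * t\<^sup>2 + 2 * s\<^sup>2"
    using zero_le_power2[of "\<bar>t\<bar> - s"] by (simp add: power2_eq_square algebra_simps)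
  finally have "1 + z\<^sup>2 \<le> (2 + 2 * s\<^sup>2) * (1 + t\<^sup>2)"
    using mult_nonneg_nonneg[OF zero_le_power2[of s] zero_le_power2[of t]]
    unfolding distrib_left distrib_right mult_1_left mult_1_right by linarith
  then have "s / ((2 + 2 * s\<^sup>2) * (1 + t\<^sup>2)) \<le> s / (1 + z\<^sup>2)"
    using assms one_plus_square_pos[of z] by (intro divide_left_mono) (auto intro!: mult_pos_pos simp: add_pos_nonneg)
  then show ?thesis using eq by (simp add: divide_inverse)
qed

lemma barrier_superharmonic:
  obtains c where "0 < c"
    "\<And>t. c / (1 + t\<^sup>2) + (\<Sum>k\<in>I. (u k + v k) * barrier (t - l k)) \<le> barrier t"
proof
  define c where "c = (\<Sum>k\<in>I. (u k + v k) * (l k / (2 + 2 * (l k)\<^sup>2)))"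
  obtain j where "j \<in> I" "0 < u j + v j" using exists_weight_pos by auto
  then show "0 < c"
    unfolding c_def using finite l_pos p_nonneg
    by (intro sum_pos2[of _ j]) (auto intro!: mult_nonneg_nonneg divide_nonneg_nonneg divide_pos_pos mult_pos_pos simp: less_imp_le add_pos_nonneg)
  fix t
  have "c / (1 + t\<^sup>2) = (\<Sum>k\<in>I. (u k + v k) * (l k / (2 + 2 * (l k)\<^sup>2) / (1 + t\<^sup>2)))"
    by (simp add: c_def sum_divide_distrib)
  also have "\<dots> \<le> (\<Sum>k\<in>I. (u k + v k) * (barrier t - barrier (t - l k)))"
    using arctan_increment_ge l_pos p_nonneg by (intro sum_mono mult_left_mono) (auto simp: barrier_def)
  also have "\<dots> = barrier t - (\<Sum>k\<in>I. (u k + v k) * barrier (t - l k))"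
    using total by (simp add: right_diff_distrib sum_subtractf flip: sum_distrib_right)
  finally show "c / (1 + t\<^sup>2) + (\<Sum>k\<in>I. (u k + v k) * barrier (t - l k)) \<le> barrier t" by simp
qed

text \<open>One constant is fixed for the locale so that forcing bounds can be stated as multiples
  of \<open>barrier_const / (1 + t\<^sup>2)\<close>; the multiple is then exactly the factor of
  \<open>barrier\<close> in the bound on the solution.\<close>

definition barrier_const :: real where
  "barrier_const = (SOME c. 0 < c \<and>
     (\<forall>t. c / (1 + t\<^sup>2) + (\<Sum>k\<in>I. (u k + v k) * barrier (t - l k)) \<le> barrier t))"

lemma barrier_const:
  "0 < barrier_const"
  "barrier_const / (1 + t\<^sup>2) + (\<Sum>k\<in>I. (u k + v k) * barrier (t - l k)) \<le> barrier t"
proof -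
  have "0 < barrier_const \<and>
     (\<forall>t. barrier_const / (1 + t\<^sup>2) + (\<Sum>k\<in>I. (u k + v k) * barrier (t - l k)) \<le> barrier t)"
    unfolding barrier_const_def by (rule someI_ex) (metis barrier_superharmonic)
  then show "0 < barrier_const"
    "barrier_const / (1 + t\<^sup>2) + (\<Sum>k\<in>I. (u k + v k) * barrier (t - l k)) \<le> barrier t" by auto
qed

section \<open>Comparison, uniqueness and a priori bounds\<close>

lemma comparison:
  assumes W: "solves X W" and X: "\<And>t. \<bar>X t\<bar> \<le> e * barrier_const / (1 + t\<^sup>2)" and "0 \<le> e"
  shows "\<bar>W t\<bar> \<le> e * barrier t"
proof -
  \<comment> \<open>Since |u - v| \<le> u + v, |W| is subharmonic up to |X|, and the defect of the
    barrier absorbs that term.\<close>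
  define D where "D t = \<bar>W t\<bar> - e * barrier t" for t
  have "D t \<le> (\<Sum>k\<in>I. (u k + v k) * D (t - l k))" for t
  proof -
    have "\<bar>W t\<bar> \<le> \<bar>X t\<bar> + \<bar>\<Sum>k\<in>I. (u k - v k) * W (t - l k)\<bar>"
      using solves_eq[OF W, of t] by linarith
    also have "\<dots> \<le> e * barrier_const / (1 + t\<^sup>2) + (\<Sum>k\<in>I. (u k + v k) * \<bar>W (t - l k)\<bar>)"
      by (intro add_mono X abs_sum_le)
        (auto simp: abs_mult intro!: mult_right_mono abs_q_le)
    moreover have "e * (barrier_const / (1 + t\<^sup>2) + (\<Sum>k\<in>I. (u k + v k) * barrier (t - l k))) \<le> e * barrier t"
      using barrier_const(2) \<open>0 \<le> e\<close> by (rule mult_left_mono)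
    ultimately show ?thesis
      by (simp add: D_def right_diff_distrib sum_subtractf sum_distrib_left algebra_simps)
  qed
  moreover have "(D \<longlongrightarrow> 0) at_bot"
  proof -
    have "((\<lambda>t. \<bar>W t\<bar> - e * barrier t) \<longlongrightarrow> \<bar>0\<bar> - e * 0) at_bot"
      by (intro tendsto_intros solves_at_bot[OF W] tendsto_barrier)
    then show ?thesis by (simp add: D_def [abs_def])
  qed
  ultimately have "D t \<le> 0" by (rule subharmonic_nonpos)
  then show ?thesis by (simp add: D_def)
qed

lemma solves_diff:
  assumes "solves X W" "solves X' W'"
  shows "solves (\<lambda>t. X t - X' t) (\<lambda>t. W t - W' t)"
proof -
  have lim: "((\<lambda>t. W t - W' t) \<longlongrightarrow> 0 - 0) at_bot"
    by (intro tendsto_diff solves_at_bot[OF assms(1)] solves_at_bot[OF assms(2)])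
  have eq: "W t - W' t = (X t - X' t) + (\<Sum>k\<in>I. (u k - v k) * (W (t - l k) - W' (t - l k)))" for t
    using solves_eq[OF assms(1), of t] solves_eq[OF assms(2), of t]
    by (simp add: right_diff_distrib sum_subtractf)
  show ?thesis by (rule solvesI[OF eq]) (use lim in simp)
qed

lemma solves_shift:
  assumes "solves X W"
  shows "solves (\<lambda>t. X (t + h)) (\<lambda>t. W (t + h))"
proof -
  have lim: "((\<lambda>t. W (t + h)) \<longlongrightarrow> 0) at_bot"
  proof (rule filterlim_compose[of W])
    show "filterlim (\<lambda>t. t + h) at_bot at_bot" by real_asymp
  qed (rule solves_at_bot[OF assms])
  have eq: "W (t + h) = X (t + h) + (\<Sum>k\<in>I. (u k - v k) * W (t - l k + h))" for t
    using solves_eq[OF assms, of "t + h"] by (simp add: algebra_simps)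
  show ?thesis by (rule solvesI[OF eq]) (use lim in simp)
qed

lemma solves_unique:
  assumes "solves X W" "solves X W'"
  shows "W = W'"
proof
  fix t
  \<comment> \<open>The difference has zero forcing, so \<open>comparison\<close> applies with e =
    0.\<close>
  show "W t = W' t" using comparison[OF solves_diff[OF assms], of 0 t] by simp
qed

lemma tame_bound:
  assumes "quadratically_tame X"
  obtains K where "0 \<le> K" "\<And>t. \<bar>X t\<bar> \<le> K * barrier_const / (1 + t\<^sup>2)"
proof -
  obtain C where C: "\<And>t. \<bar>X t\<bar> \<le> C / (1 + t\<^sup>2)"
    using assms by (auto simp: quadratically_tame_def)
  have "0 \<le> C" using C[of 0] by simp
  then show ?thesis
    using that[of "C / barrier_const"] barrier_const(1) C by simp
qed

lemma solves_bounded: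
  assumes "solves X W" "quadratically_tame X"
  obtains B where "0 \<le> B" "\<And>t. \<bar>W t\<bar> \<le> B"
proof -
  obtain K where K: "0 \<le> K" "\<And>t. \<bar>X t\<bar> \<le> K * barrier_const / (1 + t\<^sup>2)"
    using tame_bound[OF assms(2)] by blast
  have "\<bar>W t\<bar> \<le> K * pi" for t
    using comparison[OF assms(1) K(2,1), of t] mult_left_mono[OF barrier_le_pi K(1)] by (rule order_trans)
  then show ?thesis using that[of "K * pi"] K(1) by simp
qed

lemma solves_uniformly_continuous:
  assumes W: "solves X W" and "quadratically_tame X"
  shows "uniformly_continuous_on UNIV W"
  unfolding uniformly_continuous_on_def
proof (intro allI impI)
  fix e :: real assume e: "0 < e"
  \<comment> \<open>The barrier is at most pi, so increments of \<open>W\<close> are bounded by e'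
    pi = e/2.\<close>
  define e' where "e' = e / (2 * pi)"
  have e': "0 < e'" using e by (simp add: e'_def)
  then obtain d where d: "0 < d"
    "\<And>h t. \<bar>h\<bar> < d \<Longrightarrow> \<bar>X (t + h) - X t\<bar> \<le> e' * barrier_const / (1 + t\<^sup>2)"
    using assms(2) barrier_const(1) e' mult_pos_pos[of e' barrier_const]
    unfolding quadratically_tame_def by blast
  have "dist (W s) (W t) < e" if "dist s t < d" for s t
  proof -
    have "\<bar>W (t + (s - t)) - W t\<bar> \<le> e' * barrier t"
      using that e' d(2)[of "s - t"]
      by (intro comparison[OF solves_diff[OF solves_shift[OF W] W]]) (auto simp: dist_real_def)
    also have "\<dots> \<le> e' * pi" using e' barrier_le_pi by (simp add: mult_left_mono)
    also have "\<dots> < e" using e by (simp add: e'_def)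
    finally show ?thesis by (simp add: dist_real_def)
  qed
  then show "\<exists>d>0. \<forall>t\<in>UNIV. \<forall>s\<in>UNIV. dist s t < d \<longrightarrow> dist (W s) (W t) < e"
    using d(1) by auto
qed

section \<open>Existence by the Neumann series\<close>

definition transfer :: "('a \<Rightarrow> real) \<Rightarrow> (real \<Rightarrow> real) \<Rightarrow> real \<Rightarrow> real" where
  "transfer q f t = (\<Sum>k\<in>I. q k * f (t - l k))"

text \<open>The total absolute weight may equal 1, so there is no contraction to rely on. Instead
  the terms are dominated by differences of iterates of the barrier, which telescope to at most
  \<open>K * barrier t\<close>; this also gives the limit at minus infinity.\<close>

lemma solves_exists:
  assumes "quadratically_tame X"
  shows "\<exists>W. solves X W"
proof -
  obtain K where K: "0 \<le> K" "\<And>t. \<bar>X t\<bar> \<le> K * barrier_const / (1 + t\<^sup>2)"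
    using tame_bound[OF assms] by blast
  let ?P = "transfer (\<lambda>k. u k + v k)" and ?Q = "transfer (\<lambda>k. u k - v k)"
  define x where "x n = (?Q ^^ n) X" for n
  define b where "b n = (?P ^^ n) barrier" for n
  have b_nonneg: "0 \<le> b n t" for n t
  proof (induction n arbitrary: t)
    case 0 then show ?case by (simp add: b_def barrier_nonneg)
  next
    case (Suc n)
    then have "0 \<le> ?P (b n) t"
      unfolding transfer_def by (intro sum_nonneg mult_nonneg_nonneg p_nonneg)
    then show ?case by (simp add: b_def)
  qed
  \<comment> \<open>For n = 0 this is the defect of the barrier. Each application of
    \<open>transfer\<close> with signed weights is dominated by the one with weights u + v, which
    turns \<open>b n\<close> into \<open>b (Suc n)\<close>.\<close>
  have x_le: "\<bar>x n t\<bar> \<le> K * (b n t - b (Suc n) t)" for n t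
  proof (induction n arbitrary: t)
    case 0
    have "K * (barrier_const / (1 + t\<^sup>2)) \<le> K * (barrier t - ?P barrier t)"
      using barrier_const(2)[of t] K(1) by (intro mult_left_mono) (auto simp: transfer_def)
    then show ?case using K(2)[of t] by (simp add: x_def b_def)
  next
    case (Suc n)
    have "\<bar>?Q (x n) t\<bar> \<le> (\<Sum>k\<in>I. (u k + v k) * (K * (b n (t - l k) - b (Suc n) (t - l k))))"
      unfolding transfer_def
      by (intro abs_sum_le)
        (auto simp: abs_mult intro!: mult_mono abs_q_le Suc.IH p_nonneg)
    also have "\<dots> = K * (?P (b n) t - ?P (b (Suc n)) t)"
      by (simp add: transfer_def sum_distrib_left flip: sum_subtractf)
        (simp add: algebra_simps)
    finally show ?case by (simp add: x_def b_def)
  qed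
  have partial: "(\<Sum>i<n. \<bar>x i t\<bar>) \<le> K * barrier t" for n t
  proof -
    have "(\<Sum>i<n. \<bar>x i t\<bar>) \<le> (\<Sum>i<n. K * (b i t - b (Suc i) t))"
      by (intro sum_mono x_le)
    also have "\<dots> = K * (b 0 t - b n t)"
      using sum_lessThan_telescope'[of "\<lambda>i. b i t" n] by (simp flip: sum_distrib_left)
    also have "\<dots> \<le> K * barrier t"
      using b_nonneg[of n t] K(1) by (intro mult_left_mono) (auto simp: b_def)
    finally show ?thesis .
  qed
  have summ: "summable (\<lambda>n. \<bar>x n t\<bar>)" for t
    by (rule summableI_nonneg_bounded[OF _ partial]) auto
  define W where "W t = (\<Sum>n. x n t)" for t
  have sums: "(\<lambda>n. x n t) sums W t" for t
    unfolding W_def by (rule summable_sums[OF summable_rabs_cancel[OF summ]])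
  have W_le: "\<bar>W t\<bar> \<le> K * barrier t" for t
    unfolding W_def using summable_rabs[OF summ] suminf_le_const[OF summ partial] by (rule order_trans)
  have "((\<lambda>t. W t) \<longlongrightarrow> 0) at_bot"
  proof (rule Lim_null_comparison)
    show "((\<lambda>t. K * barrier t) \<longlongrightarrow> 0) at_bot"
      using tendsto_mult_right_zero[OF tendsto_barrier] .
  qed (simp add: W_le)
  moreover have "W t = X t + (\<Sum>k\<in>I. (u k - v k) * W (t - l k))" for t
  proof -
    \<comment> \<open>The finite sum over delays acts termwise and moves the series by one index;
      restoring the term \<open>x 0 = X\<close> gives the equation.\<close>
    have "(\<lambda>n. x (Suc n) t) sums (\<Sum>k\<in>I. (u k - v k) * W (t - l k))"
      unfolding x_def by (simp add: transfer_def) (intro sums_sum sums_mult sums[unfolded x_def])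
    then have "(\<lambda>n. x n t) sums ((\<Sum>k\<in>I. (u k - v k) * W (t - l k)) + x 0 t)"
      by (rule sums_Suc)
    from sums_unique2[OF sums this] show ?thesis by (simp add: x_def)
  qed
  ultimately show ?thesis using solvesI by blast
qed

section \<open>Energy estimate and slow variation\<close>

lemma total_mult: "(\<Sum>k\<in>I. (u k + v k) * c) = c"
  using total by (simp flip: sum_distrib_right)

lemma solves_asymptotic_reflection:
  assumes W: "solves X W" and tame: "quadratically_tame X" and k: "k \<in> I"
  shows "0 < u k \<Longrightarrow> asymptotic_period W (l k)"
    and "0 < v k \<Longrightarrow> ((\<lambda>t. W (t - l k) + W t) \<longlongrightarrow> 0) at_top"
proof -
  have uc: "uniformly_continuous_on UNIV W"
    using solves_uniformly_continuous[OF W tame] .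
  then have "continuous_on UNIV (\<lambda>t. (W t)\<^sup>2)"
    by (intro continuous_intros uniformly_continuous_imp_continuous)
  then obtain G where G: "\<And>t. (G has_real_derivative (W t)\<^sup>2) (at t)"
    using continuous_antiderivative by blast
  obtain B where B: "0 \<le> B" "\<And>t. \<bar>W t\<bar> \<le> B" using solves_bounded[OF W tame] by blast
  obtain C where C: "\<And>t. \<bar>X t\<bar> \<le> C / (1 + t\<^sup>2)"
    using tame by (auto simp: quadratically_tame_def)
  \<comment> \<open>\<open>E\<close> is the energy \<open>\<Sum>j. (u j + v j) * \<integral>(t - l j)..t. W\<^sup>2\<close>; its derivative is
    \<open>2 W X - Q\<close>, so adding a multiple of \<open>arctan\<close> to \<open>- E\<close> absorbs the indefinite term.\<close>
  define E where "E t = (\<Sum>j\<in>I. (u j + v j) * (G t - G (t - l j)))" for t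
  define Q where "Q t = (\<Sum>j\<in>I. u j * (W (t - l j) - W t)\<^sup>2 + v j * (W (t - l j) + W t)\<^sup>2)" for t
  define F where "F t = 2 * B * C * arctan t - E t" for t
  \<comment> \<open>Expanding the squares, the cross terms add up to -2 W(t) times the delayed sum
    in the equation, which equals W(t) - X(t).\<close>
  have Q_eq: "Q t = 2 * W t * X t - ((W t)\<^sup>2 - (\<Sum>j\<in>I. (u j + v j) * (W (t - l j))\<^sup>2))" for t
  proof -
    have "Q t = (\<Sum>j\<in>I. (u j + v j) * (W (t - l j))\<^sup>2 + (u j + v j) * (W t)\<^sup>2
        - 2 * W t * ((u j - v j) * W (t - l j)))"
      unfolding Q_def by (intro sum.cong) (auto simp: power2_eq_square algebra_simps)
    also have "\<dots> = (\<Sum>j\<in>I. (u j + v j) * (W (t - l j))\<^sup>2) + (W t)\<^sup>2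
        - 2 * W t * (\<Sum>j\<in>I. (u j - v j) * W (t - l j))"
      by (simp only: sum_subtractf sum.distrib total_mult sum_distrib_left)
    also have "(\<Sum>j\<in>I. (u j - v j) * W (t - l j)) = W t - X t"
      using solves_eq[OF W, of t] by simp
    finally show ?thesis by (simp add: power2_eq_square algebra_simps)
  qed
  have DE: "(E has_real_derivative (W t)\<^sup>2 - (\<Sum>j\<in>I. (u j + v j) * (W (t - l j))\<^sup>2)) (at t)" for t
  proof -
    have "(E has_real_derivative (\<Sum>j\<in>I. (u j + v j) * ((W t)\<^sup>2 - (W (t - l j))\<^sup>2))) (at t)"
      unfolding E_def by (intro DERIV_sum DERIV_cmult increment_has_derivative[of G] G)
    then show ?thesis by (simp add: right_diff_distrib sum_subtractf total_mult)
  qed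
  have DF: "(F has_real_derivative 2 * B * C / (1 + t\<^sup>2) - 2 * W t * X t + Q t) (at t)" for t
    unfolding F_def Q_eq
    by (auto intro!: derivative_eq_intros DE simp: divide_inverse algebra_simps)
  \<comment> \<open>With this bound the derivative of \<open>F\<close> is at least \<open>Q\<close>,
    hence at least each single square in it.\<close>
  have WX: "2 * W t * X t \<le> 2 * B * C / (1 + t\<^sup>2)" for t
  proof -
    have "W t * X t \<le> \<bar>W t\<bar> * \<bar>X t\<bar>" by (metis abs_ge_self abs_mult)
    also have "\<dots> \<le> B * (C / (1 + t\<^sup>2))" using B C by (intro mult_mono) auto
    finally show ?thesis by simp
  qed
  have E_bound: "\<bar>E t\<bar> \<le> (\<Sum>j\<in>I. (u j + v j) * (l j * B\<^sup>2))" for t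
    unfolding E_def
  proof (rule abs_sum_le)
    fix j assume j: "j \<in> I"
    obtain z where z: "G t - G (t - l j) = l j * (W z)\<^sup>2"
      using antiderivative_increment[OF G l_pos[OF j]] by metis
    have "(W z)\<^sup>2 \<le> B\<^sup>2" using B by (metis abs_le_square_iff abs_of_nonneg)
    then show "\<bar>(u j + v j) * (G t - G (t - l j))\<bar> \<le> (u j + v j) * (l j * B\<^sup>2)"
      using p_nonneg[OF j] l_pos[OF j] by (auto simp: z abs_mult intro!: mult_left_mono)
  qed
  have C0: "0 \<le> C" using C[of 0] by simp
  have F_bound: "F t \<le> 2 * B * C * (pi / 2) + (\<Sum>j\<in>I. (u j + v j) * (l j * B\<^sup>2))" for t
  proof -
    have "2 * B * C * arctan t \<le> 2 * B * C * (pi / 2)"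
      using arctan_ubound[of t] B(1) C0 by (intro mult_left_mono) auto
    then show ?thesis using E_bound[of t] by (simp add: F_def)
  qed
  have Q_ge: "u k * (W (t - l k) - W t)\<^sup>2 + v k * (W (t - l k) + W t)\<^sup>2 \<le> Q t" for t
    unfolding Q_def using k finite u_nonneg v_nonneg
    by (intro member_le_sum[of k I "\<lambda>j. u j * (W (t - l j) - W t)\<^sup>2 + v j * (W (t - l j) + W t)\<^sup>2"]) auto
  have nonneg: "0 \<le> u k * x\<^sup>2" "0 \<le> v k * x\<^sup>2" for x
    using u_nonneg[OF k] v_nonneg[OF k] by auto
  show "asymptotic_period W (l k)" if "0 < u k"
    unfolding asymptotic_period_def
  proof (rule bounded_monotone_square_derivative[OF DF F_bound that])
    show "u k * (W (t - l k) - W t)\<^sup>2 \<le> 2 * B * C / (1 + t\<^sup>2) - 2 * W t * X t + Q t" for t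
      using Q_ge[of t] WX[of t] nonneg(2)[of "W (t - l k) + W t"] by linarith
  qed (intro uniformly_continuous_on_diff uniformly_continuous_shift uc)
  show "((\<lambda>t. W (t - l k) + W t) \<longlongrightarrow> 0) at_top" if "0 < v k"
  proof (rule bounded_monotone_square_derivative[OF DF F_bound that])
    show "v k * (W (t - l k) + W t)\<^sup>2 \<le> 2 * B * C / (1 + t\<^sup>2) - 2 * W t * X t + Q t" for t
      using Q_ge[of t] WX[of t] nonneg(1)[of "W (t - l k) - W t"] by linarith
  qed (intro uniformly_continuous_on_add uniformly_continuous_shift uc)
qed

text \<open>Shifting by \<open>l k\<close> asymptotically preserves \<open>W\<close> if u k > 0 and
  flips its sign if v k > 0; doing it twice preserves \<open>W\<close> in both cases.\<close>

lemma solves_double_period: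
  assumes W: "solves X W" "quadratically_tame X" and k: "k \<in> I" "0 < u k + v k"
  shows "asymptotic_period W (2 * l k)"
proof (cases "0 < u k")
  case True
  then show ?thesis
    using asymptotic_period_int_mult[OF solves_asymptotic_reflection(1)[OF W k(1)], of 2] by simp
next
  case False
  then have lim: "((\<lambda>t. W (t - l k) + W t) \<longlongrightarrow> 0) at_top"
    using k solves_asymptotic_reflection(2)[OF W k(1)] by simp
  from filterlim_compose[OF this filterlim_minus_const_at_top]
  have "((\<lambda>t. W (t - l k - l k) + W (t - l k)) \<longlongrightarrow> 0) at_top" .
  from tendsto_diff[OF this lim] show ?thesis
    by (simp add: asymptotic_period_def algebra_simps)
qed

lemma solves_slowly_varying:
  assumes W: "solves X W" "quadratically_tame X"
    and "i \<in> I" "j \<in> I" "0 < u i + v i" "0 < u j + v j" and irrational: "l i / l j \<notin> \<rat>"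
  shows "asymptotic_period W s"
proof (rule asymptotic_period_dense)
  show "2 * l i / (2 * l j) \<notin> \<rat>" using irrational by simp
qed (use assms solves_double_period solves_uniformly_continuous in auto)

section \<open>Limits at plus infinity\<close>

lemma solves_tendsto_0:
  assumes W: "solves X W" "quadratically_tame X"
    and slow: "\<And>s. asymptotic_period W s" and k: "k \<in> I" "0 < v k"
  shows "(W \<longlongrightarrow> 0) at_top"
proof -
  \<comment> \<open>Shifting by \<open>l k\<close> both flips the sign of \<open>W\<close> and
    preserves \<open>W\<close> asymptotically; the difference of the two relations is 2
    W(t).\<close>
  have "((\<lambda>t. (W (t - l k) + W t) - (W (t - l k) - W t)) \<longlongrightarrow> 0 - 0) at_top"
    using solves_asymptotic_reflection(2)[OF W k] slow
    by (intro tendsto_diff) (auto simp: asymptotic_period_def)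
  from tendsto_mult_left[OF this, of "1/2"] show ?thesis by simp
qed

lemma solves_tendsto_integral:
  assumes W: "solves X W" "quadratically_tame X" and contX: "continuous_on UNIV X"
    and slow: "\<And>s. asymptotic_period W s" and v0: "\<And>k. k \<in> I \<Longrightarrow> v k = 0"
  shows "(W \<longlongrightarrow> (LINT t|lebesgue. X t) / (\<Sum>k\<in>I. u k * l k)) at_top"
proof -
  have uc: "uniformly_continuous_on UNIV W" using solves_uniformly_continuous[OF W] .
  then obtain H where H: "\<And>t. (H has_real_derivative W t) (at t)"
    using continuous_antiderivative uniformly_continuous_imp_continuous by blast
  have tot: "(\<Sum>k\<in>I. u k * c) = c" for c
    using total_mult[of c] v0 by simp
  \<comment> \<open>\<open>Phi\<close> is \<open>\<Sum>k. u k * \<integral>(t - l k)..t. W\<close>, the conserved quantity: \<open>Phi' = X\<close>.\<close>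
  define Phi where "Phi t = (\<Sum>k\<in>I. u k * (H t - H (t - l k)))" for t
  define J where "J = (\<Sum>k\<in>I. u k * l k)"
  have "(Phi has_real_derivative X t) (at t)" for t
  proof -
    have "(Phi has_real_derivative (\<Sum>k\<in>I. u k * (W t - W (t - l k)))) (at t)"
      unfolding Phi_def by (intro DERIV_sum DERIV_cmult increment_has_derivative H)
    moreover have "(\<Sum>k\<in>I. u k * (W t - W (t - l k))) = X t"
      using solves_eq[OF W(1), of t] v0 by (simp add: right_diff_distrib sum_subtractf tot)
    ultimately show ?thesis by simp
  qed
  moreover obtain C where "\<And>t. \<bar>X t\<bar> \<le> C / (1 + t\<^sup>2)"
    using W(2) by (auto simp: quadratically_tame_def)
  ultimately have int: "((\<lambda>t. Phi t - Phi (- t)) \<longlongrightarrow> (LINT t|lebesgue. X t)) at_top"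
    using contX integrable_quadratic_decay by (intro tendsto_symmetric_integral) auto
  \<comment> \<open>Each window integral is \<open>l k\<close> times a value of \<open>W\<close> at
    an earlier point, and \<open>W\<close> vanishes at minus infinity. Hence the total increment of
    \<open>Phi\<close> is its limit at plus infinity.\<close>
  have "(Phi \<longlongrightarrow> (\<Sum>k\<in>I. u k * 0)) at_bot"
    unfolding Phi_def
  proof (intro tendsto_sum tendsto_mult_left)
    fix k assume k: "k \<in> I"
    show "((\<lambda>t. H t - H (t - l k)) \<longlongrightarrow> 0) at_bot"
      unfolding tendsto_iff
    proof (intro allI impI)
      fix e :: real assume e: "0 < e"
      have "\<forall>\<^sub>F t in at_bot. dist (W t) 0 < e / l k"
        using solves_at_bot[OF W(1)] e l_pos[OF k] by (intro tendstoD) auto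
      then obtain T where T: "\<And>t. t \<le> T \<Longrightarrow> \<bar>W t\<bar> < e / l k"
        by (auto simp: eventually_at_bot_linorder)
      show "\<forall>\<^sub>F t in at_bot. dist (H t - H (t - l k)) 0 < e"
        using eventually_le_at_bot[of T]
      proof eventually_elim
        case (elim t)
        obtain z where z: "z < t" "H t - H (t - l k) = l k * W z"
          using antiderivative_increment[OF H l_pos[OF k]] by metis
        then show ?case
          using T[of z] elim l_pos[OF k] by (simp add: dist_real_def abs_mult field_simps)
      qed
    qed
  qed
  then have "((\<lambda>t. Phi (- t)) \<longlongrightarrow> 0) at_top"
    using filterlim_compose[OF _ filterlim_uminus_at_bot_at_top] by auto
  from tendsto_add[OF int this] have Phi: "(Phi \<longlongrightarrow> (LINT t|lebesgue. X t)) at_top" by simp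
  \<comment> \<open>By slow variation each window integral is asymptotically
    \<open>l k * W t\<close>, so \<open>Phi\<close> is asymptotically \<open>J * W\<close>.\<close>
  have "((\<lambda>t. \<Sum>k\<in>I. u k * (H t - H (t - l k) - l k * W t)) \<longlongrightarrow> (\<Sum>k\<in>I. u k * 0)) at_top"
    by (intro tendsto_sum tendsto_mult_left slowly_varying_mean uc slow H l_pos)
  moreover have "(\<Sum>k\<in>I. u k * (H t - H (t - l k) - l k * W t)) = Phi t - J * W t" for t
    by (simp add: Phi_def J_def sum_distrib_right flip: sum_subtractf) (simp add: algebra_simps)
  ultimately have "((\<lambda>t. Phi t - J * W t) \<longlongrightarrow> 0) at_top" by simp
  from tendsto_diff[OF Phi this] have "((\<lambda>t. J * W t) \<longlongrightarrow> (LINT t|lebesgue. X t)) at_top" by simp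
  moreover have "0 < J"
  proof -
    obtain k where "k \<in> I" "0 < u k" using exists_weight_pos v0 by auto
    then show ?thesis
      unfolding J_def using finite l_pos u_nonneg
      by (intro sum_pos2[of _ k]) (auto intro!: mult_nonneg_nonneg simp: less_imp_le)
  qed
  ultimately have "((\<lambda>t. J * W t / J) \<longlongrightarrow> (LINT t|lebesgue. X t) / J) at_top"
    by (intro tendsto_divide tendsto_const) auto
  then show ?thesis using \<open>0 < J\<close> by (simp add: J_def)
qed

end

subsection \<open>The coupled system\<close>

text \<open>A rational ratio puts \<open>l i\<close> into the span of \<open>l j\<close>, and
  injectivity of the family keeps \<open>l j\<close> present after \<open>l i\<close> is removed,
  contradicting independence.\<close>

lemma rat_independent_family_ratio:
  assumes ind: "rat_independent_family K l" and ij: "i \<in> K" "j \<in> K" "i \<noteq> j"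
  shows "l i / l j \<notin> \<rat>"
proof
  interpret vector_space "\<lambda>q. (*) (real_of_rat q)" by (rule vector_space_real_over_rat)
  assume "l i / l j \<in> \<rat>"
  then obtain q where q: "l i / l j = real_of_rat q" by (auto elim: Rats_cases)
  have inj: "inj_on l K" and indep: "independent (l ` K)"
    using ind by (auto simp: rat_independent_family_def)
  have "l j \<noteq> l i" using inj ij by (auto dest: inj_onD)
  \<comment> \<open>Division by zero yields the rational number 0, so this case has to be excluded
    separately.\<close>
  have "l j \<noteq> 0"
    using indep ij(2) dependent_zero[of "l ` K"] by (metis imageI)
  then have "l i = real_of_rat q * l j" using q by (simp add: field_simps)
  moreover have "l j \<in> span (l ` K - {l i})"
    using ij \<open>l j \<noteq> l i\<close> by (intro span_base) auto
  ultimately have "l i \<in> span (l ` K - {l i})" by (metis span_scale)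
  then show False using indep ij(1) by (auto simp: dependent_def)
qed

lemma renewal_solutionD:
  assumes "renewal_solution N u v l X1 X2 (Z1, Z2)"
  shows "continuous_on UNIV Z1" "continuous_on UNIV Z2"
    and "Z1 t = X1 t + (\<Sum>k=1..N. u k * Z1 (t - l k) + v k * Z2 (t - l k))"
    and "Z2 t = X2 t + (\<Sum>k=1..N. u k * Z2 (t - l k) + v k * Z1 (t - l k))"
    and "(Z1 \<longlongrightarrow> 0) at_bot" "(Z2 \<longlongrightarrow> 0) at_bot"
  using assms unfolding renewal_solution_def prod.case by blast+

lemma renewal_solutionI:
  assumes "continuous_on UNIV Z1" "continuous_on UNIV Z2"
    and "\<And>t. Z1 t = X1 t + (\<Sum>k=1..N. u k * Z1 (t - l k) + v k * Z2 (t - l k))"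
    and "\<And>t. Z2 t = X2 t + (\<Sum>k=1..N. u k * Z2 (t - l k) + v k * Z1 (t - l k))"
    and "(Z1 \<longlongrightarrow> 0) at_bot" "(Z2 \<longlongrightarrow> 0) at_bot"
  shows "renewal_solution N u v l X1 X2 (Z1, Z2)"
  using assms unfolding renewal_solution_def prod.case by blast

theorem mainTheorem4:
  fixes N :: nat and u v l :: "nat \<Rightarrow> real" and X1 X2 :: "real \<Rightarrow> real" and J :: real
  assumes "\<And>k. k \<in> {1..N} \<Longrightarrow> u k \<ge> 0"
    and "\<And>k. k \<in> {1..N} \<Longrightarrow> v k \<ge> 0"
    and "\<And>k. k \<in> {1..N} \<Longrightarrow> u k + v k > 0"
    and "(\<Sum>k=1..N. v k) > 0"
    and "(\<Sum>k=1..N. u k + v k) = 1"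
    and "\<And>k. k \<in> {1..N} \<Longrightarrow> l k > 0"
    and "rat_independent_family {1..N} l"
    and "continuous_on UNIV X1" and "continuous_on UNIV X2"
    and "X1 \<in> o[at_top](\<lambda>t. 1 / t\<^sup>2)" and "X1 \<in> o[at_bot](\<lambda>t. 1 / t\<^sup>2)"
    and "X2 \<in> o[at_top](\<lambda>t. 1 / t\<^sup>2)" and "X2 \<in> o[at_bot](\<lambda>t. 1 / t\<^sup>2)"
    and "J = (\<Sum>k=1..N. (u k + v k) * l k)"
  shows "(\<exists>!Z. renewal_solution N u v l X1 X2 Z) \<and>
    (N \<ge> 2 \<longrightarrow> (\<forall>Z1 Z2. renewal_solution N u v l X1 X2 (Z1, Z2) \<longrightarrow>
      (Z1 \<longlongrightarrow> 1 / (2 * J) * (LINT t|lebesgue. X1 t + X2 t)) at_top \<and>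
      (Z2 \<longlongrightarrow> 1 / (2 * J) * (LINT t|lebesgue. X1 t + X2 t)) at_top))"
proof -
  \<comment> \<open>\<open>P\<close> governs Z1 + Z2, where all weights are positive;
    \<open>M\<close> governs Z1 - Z2, where the exchange terms enter with a minus sign.\<close>
  interpret P: signed_renewal "{1..N}" "\<lambda>k. u k + v k" "\<lambda>_. 0" l
    by standard (use assms in \<open>auto simp: less_imp_le\<close>)
  interpret M: signed_renewal "{1..N}" u v l
    by standard (use assms in auto)
  have tame: "quadratically_tame X1" "quadratically_tame X2"
    using assms(8-13) by (auto intro: quadratically_tame_smallo)
  have tameP: "quadratically_tame (\<lambda>t. X1 t + X2 t)"
    using tame by (rule quadratically_tame_add)
  have tameM: "quadratically_tame (\<lambda>t. X1 t - X2 t)"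
    using quadratically_tame_add[OF tame(1) quadratically_tame_minus[OF tame(2)]] by simp
  have solP: "P.solves (\<lambda>t. X1 t + X2 t) (\<lambda>t. Z1 t + Z2 t)"
    and solM: "M.solves (\<lambda>t. X1 t - X2 t) (\<lambda>t. Z1 t - Z2 t)"
    if R: "renewal_solution N u v l X1 X2 (Z1, Z2)" for Z1 Z2
  proof -
    show "P.solves (\<lambda>t. X1 t + X2 t) (\<lambda>t. Z1 t + Z2 t)"
    proof (rule P.solvesI)
      show "Z1 t + Z2 t = X1 t + X2 t + (\<Sum>k=1..N. (u k + v k - 0) * (Z1 (t - l k) + Z2 (t - l k)))" for t
        unfolding renewal_solutionD(3,4)[OF R, of t]
        by (simp add: algebra_simps sum.distrib)
      show "((\<lambda>t. Z1 t + Z2 t) \<longlongrightarrow> 0) at_bot"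
        using tendsto_add[OF renewal_solutionD(5,6)[OF R]] by simp
    qed
    show "M.solves (\<lambda>t. X1 t - X2 t) (\<lambda>t. Z1 t - Z2 t)"
    proof (rule M.solvesI)
      show "Z1 t - Z2 t = X1 t - X2 t + (\<Sum>k=1..N. (u k - v k) * (Z1 (t - l k) - Z2 (t - l k)))" for t
        unfolding renewal_solutionD(3,4)[OF R, of t]
        by (simp add: algebra_simps sum.distrib sum_subtractf)
      show "((\<lambda>t. Z1 t - Z2 t) \<longlongrightarrow> 0) at_bot"
        using tendsto_diff[OF renewal_solutionD(5,6)[OF R]] by simp
    qed
  qed
  have "\<exists>Z. renewal_solution N u v l X1 X2 Z"
  proof -
    obtain P M where P: "P.solves (\<lambda>t. X1 t + X2 t) P" and M: "M.solves (\<lambda>t. X1 t - X2 t) M"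
      using P.solves_exists[OF tameP] M.solves_exists[OF tameM] by blast
    \<comment> \<open>Inverts the passage to sum and difference.\<close>
    define Z1 where "Z1 t = (P t + M t) / 2" for t
    define Z2 where "Z2 t = (P t - M t) / 2" for t
    have cont: "continuous_on UNIV P" "continuous_on UNIV M"
      using P.solves_uniformly_continuous[OF P tameP] M.solves_uniformly_continuous[OF M tameM]
      by (auto intro: uniformly_continuous_imp_continuous)
    have lim: "(P \<longlongrightarrow> 0) at_bot" "(M \<longlongrightarrow> 0) at_bot"
      using P.solves_at_bot[OF P] M.solves_at_bot[OF M] by auto
    have eqP: "P t = X1 t + X2 t + (\<Sum>k=1..N. (u k + v k) * P (t - l k))" for t
      using P.solves_eq[OF P, of t] by simp
    have "renewal_solution N u v l X1 X2 (Z1, Z2)"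
    proof (rule renewal_solutionI)
      show "continuous_on UNIV Z1" "continuous_on UNIV Z2"
        unfolding Z1_def Z2_def by (intro continuous_intros cont; simp)+
      show "(Z1 \<longlongrightarrow> 0) at_bot"
        using tendsto_divide[OF tendsto_add[OF lim] tendsto_const[of 2]] by (simp add: Z1_def [abs_def])
      show "(Z2 \<longlongrightarrow> 0) at_bot"
        using tendsto_divide[OF tendsto_diff[OF lim] tendsto_const[of 2]] by (simp add: Z2_def [abs_def])
      fix t
      have "u k * Z1 (t - l k) + v k * Z2 (t - l k) =
          ((u k + v k) * P (t - l k) + (u k - v k) * M (t - l k)) / 2" for k
        by (simp add: Z1_def Z2_def field_simps)
      then have "(\<Sum>k=1..N. u k * Z1 (t - l k) + v k * Z2 (t - l k)) =
          ((\<Sum>k=1..N. (u k + v k) * P (t - l k)) + (\<Sum>k=1..N. (u k - v k) * M (t - l k))) / 2"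
        by (simp only: sum.distrib flip: sum_divide_distrib)
      then show "Z1 t = X1 t + (\<Sum>k=1..N. u k * Z1 (t - l k) + v k * Z2 (t - l k))"
        using eqP[of t] M.solves_eq[OF M, of t] unfolding Z1_def[of t] by argo
      have "u k * Z2 (t - l k) + v k * Z1 (t - l k) =
          ((u k + v k) * P (t - l k) - (u k - v k) * M (t - l k)) / 2" for k
        by (simp add: Z1_def Z2_def field_simps)
      then have "(\<Sum>k=1..N. u k * Z2 (t - l k) + v k * Z1 (t - l k)) =
          ((\<Sum>k=1..N. (u k + v k) * P (t - l k)) - (\<Sum>k=1..N. (u k - v k) * M (t - l k))) / 2"
        by (simp only: sum_subtractf flip: sum_divide_distrib)
      then show "Z2 t = X2 t + (\<Sum>k=1..N. u k * Z2 (t - l k) + v k * Z1 (t - l k))"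
        using eqP[of t] M.solves_eq[OF M, of t] unfolding Z2_def[of t] by argo
    qed
    then show ?thesis by blast
  qed
  moreover have "Z = Z'"
    if R: "renewal_solution N u v l X1 X2 Z" and R': "renewal_solution N u v l X1 X2 Z'" for Z Z'
  proof -
    obtain Z1 Z2 Z1' Z2' where Z: "Z = (Z1, Z2)" "Z' = (Z1', Z2')" by (cases Z, cases Z') auto
    have "(\<lambda>t. Z1 t + Z2 t) = (\<lambda>t. Z1' t + Z2' t)"
      using P.solves_unique solP R R' unfolding Z by blast
    moreover have "(\<lambda>t. Z1 t - Z2 t) = (\<lambda>t. Z1' t - Z2' t)"
      using M.solves_unique solM R R' unfolding Z by blast
    ultimately have "Z1 t + Z2 t = Z1' t + Z2' t" "Z1 t - Z2 t = Z1' t - Z2' t" for t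
      by (auto dest: fun_cong)
    then have "Z1 t = Z1' t \<and> Z2 t = Z2' t" for t
      by (smt (verit))
    then show ?thesis unfolding Z by auto
  qed
  moreover have "(Z1 \<longlongrightarrow> 1 / (2 * J) * (LINT t|lebesgue. X1 t + X2 t)) at_top \<and>
      (Z2 \<longlongrightarrow> 1 / (2 * J) * (LINT t|lebesgue. X1 t + X2 t)) at_top"
    if N: "2 \<le> N" and R: "renewal_solution N u v l X1 X2 (Z1, Z2)" for Z1 Z2
  proof -
    \<comment> \<open>Two delays are essential. For N = 1 the sum Z1 + Z2 is asymptotic to the
      periodization of X1 + X2 with period \<open>l 1\<close>, which need not be constant.\<close>
    have irrational: "l 1 / l 2 \<notin> \<rat>"
      using N by (intro rat_independent_family_ratio[OF assms(7)]) auto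
    have idx: "1 \<in> {1..N}" "2 \<in> {1..N}" using N by auto
    have slowP: "asymptotic_period (\<lambda>t. Z1 t + Z2 t) s" for s
      by (rule P.solves_slowly_varying[OF solP[OF R] tameP idx _ _ irrational])
        (use assms(3) idx in simp_all)
    have slowM: "asymptotic_period (\<lambda>t. Z1 t - Z2 t) s" for s
      by (rule M.solves_slowly_varying[OF solM[OF R] tameM idx _ _ irrational])
        (use assms(3) idx in simp_all)
    \<comment> \<open>A positive exchange weight is what forces Z1 - Z2 to tend to 0.\<close>
    obtain k where k: "k \<in> {1..N}" "0 < v k"
      using assms(4) sum_nonpos[of "{1..N}" v] by (meson not_less)
    define L where "L = (LINT t|lebesgue. X1 t + X2 t)"
    have limP: "((\<lambda>t. Z1 t + Z2 t) \<longlongrightarrow> L / J) at_top"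
      unfolding L_def assms(14)
      by (rule P.solves_tendsto_integral[OF solP[OF R] tameP _ slowP])
        (auto intro!: continuous_intros assms(8,9))
    have limM: "((\<lambda>t. Z1 t - Z2 t) \<longlongrightarrow> 0) at_top"
      by (rule M.solves_tendsto_0[OF solM[OF R] tameM slowM k])
    have "((\<lambda>t. ((Z1 t + Z2 t) + (Z1 t - Z2 t)) / 2) \<longlongrightarrow> (L / J + 0) / 2) at_top"
      by (intro tendsto_intros limP limM) simp
    moreover have "((\<lambda>t. ((Z1 t + Z2 t) - (Z1 t - Z2 t)) / 2) \<longlongrightarrow> (L / J - 0) / 2) at_top"
      by (intro tendsto_intros limP limM) simp
    ultimately show ?thesis unfolding L_def[symmetric] by (simp add: mult.commute)
  qed
  ultimately show ?thesis by blast
qed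

end
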